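(* Let $\mathcal M$ be a (standard) unital $C^*$-algebra. (i) If there is an almost projection sequence $\{a_n\}_{n\in\mathbb N}\subset\mathcal M$ with $a_n\ne1$ for all $n\in\mathbb N$ and $\{a_n\}\sim_{\mathrm A}\{1\}$, then $\mathcal M$ is infinite. (ii) If there are almost projection sequences $\{a_n\}_{n\in\mathbb N},\{b_n\}_{n\in\mathbb N}\subset\mathcal M$ with $a_nb_n\to0$ and $\{a_n\}\sim_{\mathrm A}\{1\}\sim_{\mathrm A}\{b_n\}$, then $\mathcal M$ is properly infinite.
   Context: A sequence $\{a_n\}_{n\in\mathbb N}\subset\mathcal M$ (not necessarily convergent) is an almost projection sequence (a.p.s.) if $\|a_n-a_n^*\|+\|a_n^2-a_n\|\to0$. A sequence $\{u_n\}_{n\in\mathbb N}\subset\mathcal M$ is an almost partial isometry sequence (a.p.i.s.) if both $\{u_nu_n^*\}$ and $\{u_n^*u_n\}$ are a.p.s. For a.p.s. $\{a_n\},\{b_n\}$, write $\{a_n\}\sim_{\mathrm A}\{b_n\}$ if there is an a.p.i.s. $\{u_n\}\subset\mathcal M$ with $\|u_nu_n^*-a_n\|+\|u_n^*u_n-b_n\|\to0$. $\{1\}$ denotes the constant sequence with value the unit. For projections $p,q\in\mathcal M$, $p\sim q$ denotes Murray–von Neumann equivalence: $u^*u=p$, $uu^*=q$ for some partial isometry $u\in\mathcal M$. $\mathcal M$ is infinite if it has a projection $p\ne1$ with $p\sim1$, and properly infinite if it has projections $p,q$ with $pq=0$ and $p\sim1\sim q$.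
   Formalization: In (i) it is additionally assumed that a_n does not converge to 1 in norm; without this (i) fails, e.g. for M = C, a_n = 1 − 1/(n+1), u_n = 1. *)

theory Defs
  imports Complex_Main
begin

text \<open>
  Unital complex C*-algebras as a type class. The distribution has no class of complex
  vector spaces, so complex scalar multiplication is added on top of the real Banach algebra
  structure and made to extend its real scalar multiplication. The normed-algebra class
  contains \<open>norm 1 = 1\<close>, which for a nonzero unital C*-algebra follows from the
  C*-identity; thus the only algebra excluded is the zero algebra.
\<close>

class cstar_algebra = real_normed_algebra_1 + banach +
  fixes scaleC :: "complex \<Rightarrow> 'a \<Rightarrow> 'a" (infixr "*\<^sub>C" 75)
    and star :: "'a \<Rightarrow> 'a"
  assumes scaleC_add_right: "c *\<^sub>C (x + y) = c *\<^sub>C x + c *\<^sub>C y"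
    and scaleC_add_left: "(c + d) *\<^sub>C x = c *\<^sub>C x + d *\<^sub>C x"
    and scaleC_scaleC: "c *\<^sub>C d *\<^sub>C x = (c * d) *\<^sub>C x"
    and scaleR_scaleC: "r *\<^sub>R x = complex_of_real r *\<^sub>C x"
    and mult_scaleC_left: "(c *\<^sub>C x) * y = c *\<^sub>C (x * y)"
    and mult_scaleC_right: "x * (c *\<^sub>C y) = c *\<^sub>C (x * y)"
    and norm_scaleC: "norm (c *\<^sub>C x) = cmod c * norm x"
    and star_star: "star (star x) = x"
    and star_add: "star (x + y) = star x + star y"
    and star_scaleC: "star (c *\<^sub>C x) = cnj c *\<^sub>C star x"
    and star_mult: "star (x * y) = star y * star x"
    and cstar_identity: "norm (star x * x) = (norm x)\<^sup>2"

definition projection :: "'a::cstar_algebra \<Rightarrow> bool" where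
  "projection p \<longleftrightarrow> star p = p \<and> p * p = p"

definition partial_isometry :: "'a::cstar_algebra \<Rightarrow> bool" where
  "partial_isometry u \<longleftrightarrow> u * star u * u = u"

definition mvn_equiv :: "'a::cstar_algebra \<Rightarrow> 'a \<Rightarrow> bool" where
  "mvn_equiv p q \<longleftrightarrow> (\<exists>u. partial_isometry u \<and> star u * u = p \<and> u * star u = q)"

definition infinite_cstar :: "'a::cstar_algebra itself \<Rightarrow> bool" where
  "infinite_cstar (_ :: 'a itself) \<longleftrightarrow>
     (\<exists>p::'a. projection p \<and> p \<noteq> 1 \<and> mvn_equiv p 1)"

definition properly_infinite_cstar :: "'a::cstar_algebra itself \<Rightarrow> bool" where
  "properly_infinite_cstar (_ :: 'a itself) \<longleftrightarrow>
     (\<exists>p q::'a. projection p \<and> projection q \<and> p * q = 0 \<and>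
        mvn_equiv p 1 \<and> mvn_equiv 1 q)"

definition almost_projection_seq :: "(nat \<Rightarrow> 'a::cstar_algebra) \<Rightarrow> bool" where
  "almost_projection_seq a \<longleftrightarrow>
     (\<lambda>n. norm (a n - star (a n)) + norm ((a n)\<^sup>2 - a n)) \<longlonglongrightarrow> 0"

definition almost_partial_isometry_seq :: "(nat \<Rightarrow> 'a::cstar_algebra) \<Rightarrow> bool" where
  "almost_partial_isometry_seq u \<longleftrightarrow>
     almost_projection_seq (\<lambda>n. u n * star (u n)) \<and>
     almost_projection_seq (\<lambda>n. star (u n) * u n)"

text \<open>Only meant to be applied to almost projection sequences.\<close>

definition almost_equiv :: "(nat \<Rightarrow> 'a::cstar_algebra) \<Rightarrow> (nat \<Rightarrow> 'a) \<Rightarrow> bool"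
    (infix "\<sim>\<^sub>A" 50) where
  "a \<sim>\<^sub>A b \<longleftrightarrow>
     (\<exists>u. almost_partial_isometry_seq u \<and>
        (\<lambda>n. norm (u n * star (u n) - a n) + norm (star (u n) * u n - b n)) \<longlonglongrightarrow> 0)"

instantiation complex :: cstar_algebra
begin

definition scaleC_complex :: "complex \<Rightarrow> complex \<Rightarrow> complex" where
  "scaleC_complex c x = c * x"

definition star_complex :: "complex \<Rightarrow> complex" where
  "star_complex = cnj"

instance
  by standard
    (simp_all add: scaleC_complex_def star_complex_def algebra_simps scaleR_conv_of_real
      norm_mult power2_eq_square)

end

text \<open>
  The termwise condition \<open>a n \<noteq> 1\<close> alone does not force infiniteness: in the algebra of complex
  numbers, which is not infinite, the sequence \<open>1 - 1/(n+1)\<close> is a counterexample. The condition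
  that rules this out is that \<open>a\<close> does not converge to \<open>1\<close>.
\<close>

lemma termwise_neq_one_insufficient:
  "\<exists>a::nat \<Rightarrow> complex. almost_projection_seq a \<and> (\<forall>n. a n \<noteq> 1) \<and> a \<sim>\<^sub>A (\<lambda>_. 1)"
  "\<not> infinite_cstar TYPE(complex)"
proof -
  define a :: "nat \<Rightarrow> complex" where "a n = of_real (1 - inverse (real (Suc n)))" for n
  have lim: "a \<longlonglongrightarrow> 1"
    unfolding a_def
    by (rule tendsto_eq_intros LIMSEQ_inverse_real_of_nat refl | simp)+
  have "almost_projection_seq a"
    unfolding almost_projection_seq_def star_complex_def
    by (rule tendsto_eq_intros lim refl | simp)+
  moreover have "a n \<noteq> 1" for n
    unfolding a_def by (simp del: of_nat_Suc of_real_diff of_real_inverse add: of_real_eq_1_iff)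
  moreover have "a \<sim>\<^sub>A (\<lambda>_. 1)"
    unfolding almost_equiv_def
  proof (intro exI conjI)
    show "almost_partial_isometry_seq (\<lambda>_. 1::complex)"
      by (simp add: almost_partial_isometry_seq_def almost_projection_seq_def star_complex_def)
    show "(\<lambda>n. norm (1 * star 1 - a n) + norm (star 1 * 1 - (1::complex))) \<longlonglongrightarrow> 0"
      unfolding star_complex_def
      by (rule tendsto_eq_intros lim refl | simp)+
  qed
  ultimately show "\<exists>a::nat \<Rightarrow> complex. almost_projection_seq a \<and> (\<forall>n. a n \<noteq> 1) \<and> a \<sim>\<^sub>A (\<lambda>_. 1)"
    by blast
  show "\<not> infinite_cstar TYPE(complex)"
    by (auto simp: infinite_cstar_def mvn_equiv_def star_complex_def mult.commute)
qed

end

theory Submission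
  imports Defs "HOL-Computational_Algebra.Formal_Power_Series"
begin

text \<open>
  If \<open>u\<^sup>* u\<close> is close to \<open>1\<close>, then \<open>v = u (u\<^sup>* u)\<^sup>-\<^sup>1\<^sup>/\<^sup>2\<close> is an isometry whose range projection is close
  to \<open>u u\<^sup>*\<close>; the inverse square root comes from the binomial series, so no functional calculus
  is needed. In (i), if all these isometries were unitary, then \<open>a\<close> would converge to \<open>1\<close>. In (ii) one gets
  isometries \<open>v, t\<close> with almost orthogonal ranges; cutting \<open>t\<close> down to \<open>(1 - v v\<^sup>*) t\<close> and
  normalising once more makes the ranges exactly orthogonal.
\<close>

text \<open>The C*-identity and submultiplicativity make \<open>star\<close> norm-nonincreasing in
  one direction; applying this to \<open>star x\<close> as well gives the other.\<close>

lemma norm_star: "norm (star x) = norm (x::'a::cstar_algebra)"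
proof -
  have le: "norm y \<le> norm (star y)" for y :: 'a
  proof (cases "y = 0")
    case False
    have "norm y * norm y \<le> norm (star y) * norm y"
      using norm_mult_ineq[of "star y" y] by (simp add: cstar_identity power2_eq_square)
    then show ?thesis using False by simp
  qed simp
  from le[of x] le[of "star x"] show ?thesis by (simp add: star_star)
qed

lemma bounded_linear_star: "bounded_linear (star :: 'a::cstar_algebra \<Rightarrow> 'a)"
  by (rule bounded_linear_intro[of _ 1])
     (simp_all add: star_add scaleR_scaleC star_scaleC norm_star)

lemmas star_diff = linear_diff[OF bounded_linear.linear[OF bounded_linear_star]]

lemma star_one: "star (1::'a::cstar_algebra) = 1"
  by (metis mult_1 mult_1_right star_mult star_star)

lemma star_power: "star (x ^ n) = star (x::'a::cstar_algebra) ^ n"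
  by (induction n) (simp_all add: star_one star_mult power_commutes)

lemma norm_isometry_le_1:
  fixes v :: "'a::cstar_algebra"
  assumes "star v * v = 1"
  shows "norm v \<le> 1"
  using cstar_identity[of v] assms norm_ge_zero[of v] by (auto simp: power2_eq_1_iff dest: sym)

text \<open>Passing from \<open>k\<close> to \<open>Suc k\<close> multiplies the absolute value by
  \<open>(k + 1/2) / (k + 1)\<close>. The bound lets a geometric series dominate the binomial series
  of exponent \<open>- 1/2\<close>.\<close>

lemma abs_gbinomial_minus_half_le_1: "\<bar>(- 1/2 :: real) gchoose k\<bar> \<le> 1"
proof (induction k)
  case (Suc k)
  have "\<bar>(- 1/2 :: real) gchoose Suc k\<bar>
      = \<bar>(- 1/2 :: real) gchoose k\<bar> * (\<bar>- 1/2 - real k\<bar> / real (Suc k))"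
    by (simp add: gbinomial_prod_rev abs_mult mult.commute)
  also have "\<dots> \<le> 1 * 1"
    using Suc by (intro mult_mono) (auto simp: field_simps)
  finally show ?case by simp
qed simp

text \<open>Here \<open>s\<close> is the binomial series of \<open>(1 + z)\<close> to the power
  \<open>- 1/2\<close> at \<open>z = h - 1\<close>. Its real coefficients and the powers of the
  self-adjoint \<open>z\<close> make it self-adjoint and make it commute with
  \<open>h\<close>.\<close>

lemma inverse_sqrt_near_one:
  fixes h :: "'a::cstar_algebra"
  assumes sa: "star h = h" and near: "norm (h - 1) < 1"
  obtains s where "star s = s" "s * h = h * s" "h * (s * s) = 1"
proof -
  define z where "z = h - 1"
  define c where "c k = ((- 1/2 :: real) gchoose k)" for k
  define f where "f k = c k *\<^sub>R z ^ k" for k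
  have z: "star z = z" "norm z < 1" "h = 1 + z"
    using sa near by (simp_all add: z_def star_diff star_one)
  have "norm (f k) \<le> norm z ^ k" for k
    using mult_mono[OF abs_gbinomial_minus_half_le_1[of k] norm_power_ineq[of z k]]
    by (simp add: f_def c_def)
  then have sn: "summable (\<lambda>k. norm (f k))"
    using z(2) by (intro summable_comparison_test'[OF summable_geometric[of "norm z"]]) auto
  then have sf: "summable f" by (rule summable_norm_cancel)
  define s where "s = suminf f"
  have star_s: "star s = s"
    unfolding s_def bounded_linear.suminf[OF bounded_linear_star sf]
    by (simp add: f_def[abs_def] linear_scale[OF bounded_linear.linear[OF bounded_linear_star]] star_power z(1))
  have comm: "s * z = z * s"
    unfolding s_def suminf_mult2[OF sf] suminf_mult[OF sf, symmetric]
    by (simp add: f_def power_commutes)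
  \<comment> \<open>Vandermonde adds the exponents: the Cauchy square of the series has coefficients
    \<open>(- 1) gchoose k = (- 1) ^ k\<close>, so \<open>s * s\<close> is the geometric series of
    \<open>- z\<close>.\<close>
  have conv: "(\<Sum>i\<le>k. f i * f (k - i)) = (- z) ^ k" for k
  proof -
    have "(\<Sum>i\<le>k. f i * f (k - i)) = (\<Sum>i\<le>k. (c i * c (k - i)) *\<^sub>R z ^ k)"
      by (intro sum.cong) (simp_all add: f_def mult.commute flip: power_add)
    also have "\<dots> = ((- 1/2 + - 1/2 :: real) gchoose k) *\<^sub>R z ^ k"
      unfolding gbinomial_Vandermonde[symmetric] c_def atMost_atLeast0
      by (simp add: scaleR_sum_left)
    also have "(- 1/2 + - 1/2 :: real) gchoose k = (- 1) ^ k"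
      using gbinomial_minus[of "1::real" k] by (simp flip: binomial_gbinomial)
    finally show ?thesis by (simp add: power_minus[of z] scaleR_conv_of_real)
  qed
  have sum_z: "summable (\<lambda>k. (- z) ^ k)"
    using z(2) by (intro complete_algebra_summable_geometric) simp
  have ss: "s * s = (\<Sum>k. (- z) ^ k)"
    unfolding s_def Cauchy_product[OF sn sn] conv ..
  \<comment> \<open>Splitting off the first term shows that the geometric sum \<open>S\<close>
    satisfies \<open>S = 1 - z * S\<close>, that is, \<open>(1 + z) * S = 1\<close>.\<close>
  have "(\<Sum>k. (- z) ^ k) = 1 + (\<Sum>k. (- z) ^ Suc k)"
    using suminf_split_head[OF sum_z] by simp
  also have "(\<Sum>k. (- z) ^ Suc k) = - z * (\<Sum>k. (- z) ^ k)"
    unfolding suminf_mult[OF sum_z, symmetric] by simp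
  finally have "h * (s * s) = 1"
    unfolding ss z(3) by (simp add: algebra_simps)
  moreover have "s * h = h * s"
    using comm by (simp add: z(3) algebra_simps)
  ultimately show ?thesis using star_s that by blast
qed

text \<open>This is the isometric part of the polar decomposition of \<open>u\<close>, with
  \<open>s\<close> the inverse square root of \<open>star u * u\<close>. The form
  \<open>v = u * s\<close> is kept in the conclusion because whatever annihilates \<open>u\<close>
  from the left then annihilates \<open>v\<close>.\<close>

lemma isometry_near:
  fixes u :: "'a::cstar_algebra"
  assumes "norm (star u * u - 1) < 1"
  obtains v s where "star v * v = 1" "v = u * s"
    "norm (v * star v - u * star u) \<le> norm (star u * u - 1)"
proof -
  define h where "h = star u * u"
  have sa: "star h = h" by (simp add: h_def star_mult star_star)
  obtain s where s: "star s = s" "s * h = h * s" "h * (s * s) = 1"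
    using inverse_sqrt_near_one[OF sa] assms by (auto simp: h_def)
  define v where "v = u * s"
  have ssh: "s * (s * h) = 1"
    using s(2,3) by (metis mult.assoc)
  have "star v * v = s * h * s"
    by (simp add: v_def h_def star_mult s(1) mult.assoc)
  then have iso: "star v * v = 1"
    using s(2,3) by (simp add: mult.assoc)
  \<comment> \<open>The element \<open>s * h\<close> is inverse to \<open>s\<close> and squares to
    \<open>h\<close>, so it acts as the square root of \<open>h\<close>.\<close>
  have u: "u = v * (s * h)"
    using ssh by (simp add: v_def mult.assoc)
  have "u * star u = v * (s * h) * star (v * (s * h))"
    using u by simp
  also have "\<dots> = v * (s * h * (h * s)) * star v"
    by (simp add: star_mult sa s(1) mult.assoc)
  also have "s * h * (h * s) = h"
    using s(2) ssh by (metis mult.assoc mult_1_right)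
  finally have "v * star v - u * star u = v * (1 - h) * star v"
    by (simp add: algebra_simps)
  also have "norm \<dots> \<le> norm v * norm (1 - h) * norm (star v)"
    by (meson norm_mult_ineq mult_right_mono norm_ge_zero order_trans)
  also have "\<dots> \<le> 1 * norm (1 - h) * 1"
    using norm_isometry_le_1[OF iso] by (intro mult_mono) (auto simp: norm_star)
  finally have "norm (v * star v - u * star u) \<le> norm (star u * u - 1)"
    by (simp add: h_def norm_minus_commute)
  with iso v_def show ?thesis using that by blast
qed

text \<open>Triangle inequality through \<open>u * star u\<close>. The sum is the one whose
  convergence to 0 defines \<open>a \<sim>\<^sub>A (\<lambda>_. 1)\<close>.\<close>

lemma isometry_near_range:
  fixes u a :: "'a::cstar_algebra"
  assumes "norm (u * star u - a) + norm (star u * u - 1) < 1"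
  obtains v where "star v * v = 1"
    "norm (v * star v - a) \<le> norm (u * star u - a) + norm (star u * u - 1)"
proof -
  have "norm (star u * u - 1) < 1"
    using assms norm_ge_zero[of "u * star u - a"] by linarith
  then obtain v s where v: "star v * v = 1"
    "norm (v * star v - u * star u) \<le> norm (star u * u - 1)"
    by (rule isometry_near)
  moreover have "norm (v * star v - a) \<le> norm (v * star v - u * star u) + norm (u * star u - a)"
    using norm_triangle_ineq[of "v * star v - u * star u" "u * star u - a"] by simp
  ultimately show ?thesis using that[of v] by linarith
qed

text \<open>The two equivalences are witnessed by \<open>v\<close> and \<open>star v\<close>. Both
  orientations are stated because \<open>properly_infinite_cstar\<close> uses one for each
  projection.\<close>

lemma isometry_range_projection:
  fixes v :: "'a::cstar_algebra"
  assumes "star v * v = 1"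
  shows "projection (v * star v)" "mvn_equiv 1 (v * star v)" "mvn_equiv (v * star v) 1"
proof -
  have "v * star v * (v * star v) = v * (star v * v) * star v"
    by (simp only: mult.assoc)
  with assms show "projection (v * star v)"
    by (simp add: projection_def star_mult star_star)
  show "mvn_equiv 1 (v * star v)"
    unfolding mvn_equiv_def partial_isometry_def
    using assms by (intro exI[of _ v]) (simp add: mult.assoc)
  show "mvn_equiv (v * star v) 1"
    unfolding mvn_equiv_def partial_isometry_def
    using assms by (intro exI[of _ "star v"]) (simp add: star_star)
qed

text \<open>By contradiction: if every isometry is unitary, the range projections approximating
  \<open>a n\<close> all equal 1, which forces \<open>a\<close> to converge to 1.\<close>

lemma infinite_if_almost:
  fixes a :: "nat \<Rightarrow> 'a::cstar_algebra"
  assumes "\<not> a \<longlonglongrightarrow> 1" "a \<sim>\<^sub>A (\<lambda>_. 1)"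
  shows "infinite_cstar TYPE('a)"
proof (rule ccontr)
  assume "\<not> infinite_cstar TYPE('a)"
  then have unitary: "v * star v = 1" if "star v * v = 1" for v :: 'a
    using isometry_range_projection[OF that] by (auto simp: infinite_cstar_def)
  obtain u where lim: "(\<lambda>n. norm (u n * star (u n) - a n) + norm (star (u n) * u n - 1)) \<longlonglongrightarrow> 0"
    (is "?d \<longlonglongrightarrow> 0")
    using assms(2) unfolding almost_equiv_def by blast
  have bound: "norm (a n - 1) \<le> ?d n" if "?d n < 1" for n
    using that by (rule isometry_near_range) (metis unitary norm_minus_commute)
  have "eventually (\<lambda>n. ?d n < 1) sequentially"
    using order_tendstoD(2)[OF lim] by simp
  then have "eventually (\<lambda>n. norm (a n - 1) \<le> ?d n) sequentially"
    by (rule eventually_mono) (rule bound)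
  then have "(\<lambda>n. a n - 1) \<longlonglongrightarrow> 0"
    by (intro tendsto_0_le[OF lim, where K = 1]) (auto elim: eventually_mono)
  then show False
    using assms(1) by (simp add: LIM_zero_iff)
qed

text \<open>The compression \<open>y = (1 - p) * t\<close> satisfies
  \<open>star y * y = 1 - star x * x\<close> with \<open>x = star v * t\<close> of norm below 1, so
  it can be normalised to an isometry.\<close>

lemma orthogonal_isometries:
  fixes v t :: "'a::cstar_algebra"
  assumes v: "star v * v = 1" and t: "star t * t = 1"
    and small: "norm (v * star v * (t * star t)) < 1"
  obtains w where "star w * w = 1" "v * star v * (w * star w) = 0"
proof -
  define p where "p = v * star v"
  define x where "x = star v * t"
  \<comment> \<open>Inserting \<open>star v * v = 1\<close> and \<open>star t * t = 1\<close> bounds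
    the norm of \<open>x\<close> by that of the product of the two range projections.\<close>
  have "x = star v * (v * star v * (t * star t)) * t"
  proof -
    have "star v * (v * star v * (t * star t)) * t = (star v * v) * star v * t * (star t * t)"
      by (simp only: mult.assoc)
    then show ?thesis by (simp add: v t x_def)
  qed
  also have "norm \<dots> \<le> norm (star v) * norm (v * star v * (t * star t)) * norm t"
    by (meson norm_mult_ineq mult_right_mono norm_ge_zero order_trans)
  also have "\<dots> \<le> 1 * norm (v * star v * (t * star t)) * 1"
    using norm_isometry_le_1[OF v] norm_isometry_le_1[OF t]
    by (intro mult_mono) (auto simp: norm_star)
  finally have "norm x < 1" using small by simp
  then have x1: "norm (star x * x) < 1"
    by (simp add: cstar_identity power_less_one_iff abs_square_less_1)
  define y where "y = (1 - p) * t"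
  have p: "star p = p" "p * p = p"
    using isometry_range_projection(1)[OF v] by (simp_all add: p_def projection_def)
  have "star y * y = star t * ((1 - p) * (1 - p)) * t"
    by (simp add: y_def star_mult star_diff star_one p(1) mult.assoc)
  also have "(1 - p) * (1 - p) = 1 - p"
    by (simp add: algebra_simps p(2))
  also have "star t * (1 - p) * t = 1 - star x * x"
    by (simp add: algebra_simps t x_def p_def star_mult star_star)
  finally have "norm (star y * y - 1) < 1"
    using x1 by simp
  then obtain w s where w: "star w * w = 1" "w = y * s"
    by (rule isometry_near)
  have "p * y = (p - p * p) * t"
    by (simp only: y_def algebra_simps mult_1_right mult_1_left)
  then have "p * y = 0" by (simp add: p(2))
  \<comment> \<open>Normalisation multiplies \<open>y\<close> on the right only, so \<open>p\<close>
    still annihilates \<open>w\<close>.\<close>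
  then have "p * (w * star w) = 0"
    unfolding w(2) by (metis mult.assoc mult_zero_left)
  with w(1) show ?thesis using that by (simp add: p_def)
qed

lemma properly_infinite_if_almost:
  fixes a b :: "nat \<Rightarrow> 'a::cstar_algebra"
  assumes ab: "(\<lambda>n. a n * b n) \<longlonglongrightarrow> 0" and a: "a \<sim>\<^sub>A (\<lambda>_. 1)" and b: "(\<lambda>_. 1) \<sim>\<^sub>A b"
  shows "properly_infinite_cstar TYPE('a)"
proof -
  obtain u where d: "(\<lambda>n. norm (u n * star (u n) - a n) + norm (star (u n) * u n - 1)) \<longlonglongrightarrow> 0"
    (is "?d \<longlonglongrightarrow> 0")
    using a unfolding almost_equiv_def by blast
  obtain w where "(\<lambda>n. norm (w n * star (w n) - 1) + norm (star (w n) * w n - b n)) \<longlonglongrightarrow> 0"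
    using b unfolding almost_equiv_def by blast
  \<comment> \<open>In \<open>(\<lambda>_. 1) \<sim>\<^sub>A b\<close> the roles of the two products
    are swapped, so \<open>star (w n)\<close> takes the place of the near-isometry.\<close>
  then have e: "(\<lambda>n. norm (star (w n) * star (star (w n)) - b n)
      + norm (star (star (w n)) * star (w n) - 1)) \<longlonglongrightarrow> 0"
    (is "?e \<longlonglongrightarrow> 0")
    by (simp add: star_star add.commute)
  \<comment> \<open>This sum bounds the norm of \<open>p * q\<close> below; the factor
    \<open>1 + ?e n\<close> is the bound for the norm of \<open>b n\<close>.\<close>
  have r: "(\<lambda>n. norm (a n * b n) + ?e n + ?d n * (1 + ?e n)) \<longlonglongrightarrow> 0"
    by (rule tendsto_eq_intros ab d e tendsto_norm refl | simp)+
  have "eventually (\<lambda>n. ?d n < 1 \<and> ?e n < 1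
      \<and> norm (a n * b n) + ?e n + ?d n * (1 + ?e n) < 1) sequentially"
    using order_tendstoD(2)[OF d, of 1] order_tendstoD(2)[OF e, of 1] order_tendstoD(2)[OF r, of 1]
    by (simp add: eventually_conj_iff)
  then obtain n where dn: "?d n < 1" and en: "?e n < 1"
    and rn: "norm (a n * b n) + ?e n + ?d n * (1 + ?e n) < 1"
    unfolding eventually_sequentially by blast
  obtain v where v: "star v * v = 1" "norm (v * star v - a n) \<le> ?d n"
    using dn by (rule isometry_near_range)
  obtain t where t: "star t * t = 1" "norm (t * star t - b n) \<le> ?e n"
    using en by (rule isometry_near_range)
  define p q where "p = v * star v" and "q = t * star t"
  have norm_range: "norm (x * star x) \<le> 1" if "star x * x = 1" for x :: 'a
    using norm_mult_ineq[of x "star x"] norm_isometry_le_1[OF that]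
    by (simp add: norm_star) (meson mult_le_one norm_ge_zero order_trans)
  have "norm (b n) \<le> norm q + norm (q - b n)"
    using norm_triangle_ineq4[of q "q - b n"] by simp
  then have nb: "norm (b n) \<le> 1 + ?e n"
    using norm_range[OF t(1)] t(2) unfolding q_def by linarith
  have "norm (p * (q - b n)) \<le> 1 * ?e n"
    unfolding p_def q_def
    by (rule order_trans[OF norm_mult_ineq]) (rule mult_mono[OF norm_range[OF v(1)] t(2)]; simp)
  moreover have "norm ((p - a n) * b n) \<le> ?d n * (1 + ?e n)"
    using v(2) nb unfolding p_def by (intro order_trans[OF norm_mult_ineq] mult_mono) auto
  \<comment> \<open>The projections are exchanged for \<open>a n\<close> and \<open>b n\<close> one
    factor at a time, leaving one error term for each exchange.\<close>
  moreover have "p * q = a n * b n + p * (q - b n) + (p - a n) * b n"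
    by (simp add: algebra_simps)
  then have "norm (p * q) \<le> norm (a n * b n) + norm (p * (q - b n)) + norm ((p - a n) * b n)"
    by (metis norm_triangle_ineq norm_triangle_le add_right_mono)
  ultimately have "norm (p * q) \<le> norm (a n * b n) + ?e n + ?d n * (1 + ?e n)"
    by (elim order_trans) (intro add_mono; simp)
  then have "norm (p * q) < 1"
    using rn by (rule le_less_trans)
  then obtain w where w: "star w * w = 1" "v * star v * (w * star w) = 0"
    using orthogonal_isometries[OF v(1) t(1)] unfolding p_def q_def by blast
  then show ?thesis
    using isometry_range_projection[OF v(1)] isometry_range_projection[OF w(1)]
    unfolding properly_infinite_cstar_def by blast
qed

theorem corollary38:
  "((\<exists>a::nat \<Rightarrow> 'a::cstar_algebra.
       almost_projection_seq a \<and> (\<forall>n. a n \<noteq> 1) \<and> \<not> a \<longlonglongrightarrow> 1 \<and> a \<sim>\<^sub>A (\<lambda>_. 1))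
     \<longrightarrow> infinite_cstar TYPE('a)) \<and>
   ((\<exists>a b::nat \<Rightarrow> 'a.
       almost_projection_seq a \<and> almost_projection_seq b \<and>
       (\<lambda>n. a n * b n) \<longlonglongrightarrow> 0 \<and> a \<sim>\<^sub>A (\<lambda>_. 1) \<and> (\<lambda>_. 1) \<sim>\<^sub>A b)
     \<longrightarrow> properly_infinite_cstar TYPE('a))"
  using infinite_if_almost properly_infinite_if_almost by blast

end
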